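(* Let $A$ be an associative unital algebra with unit $\mathbf{1}$ satisfying property $\mathbb{B}$, and let $X$ be a unital $A$-bimodule. Then the following statements are equivalent for every linear map $T: A \to X$: (i) $T$ is anti-derivable at zero. (ii) The element $T(\mathbf{1})\in X$ satisfies $T(\mathbf{1}) \cdot a = a \cdot T(\mathbf{1})$ for all $a\in A$, and there exists a linear map (actually a Jordan derivation) $d: A\to X$ such that $T(a) = d(a) + T(\mathbf{1}) \cdot a$ for all $a\in A$, and $d(b)\cdot a + b\cdot d(a) = -2\, T(\mathbf{1}) \cdot (b a)$ for all $a,b\in A$ with $a b = 0$. If we additionally assume that every Jordan derivation from $A$ to $X$ is a derivation, then statements (i) and (ii) are also equivalent to: (iii) The element $T(\mathbf{1})\in X$ satisfies $T(\mathbf{1}) \cdot a = a \cdot T(\mathbf{1})$ for all $a\in A$, and there exists a derivation $d: A\to X$ such that $T(a) = d(a) + T(\mathbf{1}) \cdot a$ and $d([a,b]) = -2\,T(\mathbf{1})\cdot [a,b]$, for all $a,b\in A$. (In particular, $T$ is a generalized derivation.)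
   Context: All algebras are complex; no topology or continuity is assumed here. $[a,b]=ab-ba$. An algebra $A$ satisfies property $\mathbb{B}$ (algebraic version) if for every $A$-bimodule $Y$, every bilinear map $\varphi: A\times A\to Y$ such that $\varphi(a,b)=0$ whenever $a,b\in A$ with $ab=0$ also satisfies $\varphi(ab,c)=\varphi(a,bc)$ for all $a,b,c\in A$. A linear map $T:A\to X$ is anti-derivable at zero if $T(b)\cdot a + b\cdot T(a)=0$ whenever $a,b\in A$ and $ab=0$. A linear map $d:A\to X$ is a derivation if $d(ab)=d(a)\cdot b+a\cdot d(b)$ for all $a,b\in A$, and a Jordan derivation if $d(a^2)=d(a)\cdot a+a\cdot d(a)$ for all $a\in A$. Here, $T$ is a generalized derivation means that there is $\xi\in X$ (namely $\xi=T(\mathbf 1)$) with $T(ab)=T(a)\cdot b+a\cdot T(b)-a\cdot\xi\cdot b$ for all $a,b\in A$. *)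

theory Defs
  imports Complex_Main
begin

text \<open>The carrier of an algebra or module is the whole type; the additive and multiplicative
  structure comes from type classes and the complex scalar multiplication is a parameter.
  The unital case uses the sort \<open>{ring, monoid_mult}\<close> rather than \<open>ring_1\<close>, because the
  latter would impose \<open>0 \<noteq> 1\<close>.\<close>

locale complex_algebra = vector_space sA
  for sA :: "complex \<Rightarrow> 'a::ring \<Rightarrow> 'a" +
  assumes scale_mult_left: "sA c a * b = sA c (a * b)"
    and scale_mult_right: "a * sA c b = sA c (a * b)"

definition bilinear_map ::
  "(complex \<Rightarrow> 'u::ab_group_add \<Rightarrow> 'u) \<Rightarrow> (complex \<Rightarrow> 'v::ab_group_add \<Rightarrow> 'v)
    \<Rightarrow> (complex \<Rightarrow> 'w::ab_group_add \<Rightarrow> 'w) \<Rightarrow> ('u \<Rightarrow> 'v \<Rightarrow> 'w) \<Rightarrow> bool" where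
  "bilinear_map sU sV sW f \<longleftrightarrow>
    (\<forall>u. Vector_Spaces.linear sV sW (f u)) \<and> (\<forall>v. Vector_Spaces.linear sU sW (\<lambda>u. f u v))"

locale bimodule = complex_algebra sA + X: vector_space sX
  for sA :: "complex \<Rightarrow> 'a::ring \<Rightarrow> 'a"
    and sX :: "complex \<Rightarrow> 'x::ab_group_add \<Rightarrow> 'x" +
  fixes lact :: "'a \<Rightarrow> 'x \<Rightarrow> 'x" (infixr "\<rhd>" 70)
    and ract :: "'x \<Rightarrow> 'a \<Rightarrow> 'x" (infixl "\<lhd>" 70)
  assumes bilinear_lact: "bilinear_map sA sX sX (\<rhd>)"
    and bilinear_ract: "bilinear_map sX sA sX (\<lhd>)"
    and lact_mult: "(a * b) \<rhd> x = a \<rhd> (b \<rhd> x)"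
    and ract_mult: "x \<lhd> (a * b) = (x \<lhd> a) \<lhd> b"
    and lact_ract: "(a \<rhd> x) \<lhd> b = a \<rhd> (x \<lhd> b)"

locale unital_bimodule = bimodule sA sX lact ract
  for sA :: "complex \<Rightarrow> 'a::{ring,monoid_mult} \<Rightarrow> 'a"
    and sX :: "complex \<Rightarrow> 'x::ab_group_add \<Rightarrow> 'x"
    and lact :: "'a \<Rightarrow> 'x \<Rightarrow> 'x" (infixr "\<rhd>" 70)
    and ract :: "'x \<Rightarrow> 'a \<Rightarrow> 'x" (infixl "\<lhd>" 70) +
  assumes lact_one: "1 \<rhd> x = x"
    and ract_one: "x \<lhd> 1 = x"

text \<open>Property \<open>\<bool>\<close> for the (not necessarily unital) bimodules \<open>Y\<close> living on a given type
  \<open>'y\<close>.\<close>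

definition property_B_on ::
  "'y::ab_group_add itself \<Rightarrow> (complex \<Rightarrow> 'a::ring \<Rightarrow> 'a) \<Rightarrow> bool" where
  "property_B_on (_ :: 'y itself) sA \<longleftrightarrow>
    (\<forall>(sY :: complex \<Rightarrow> 'y \<Rightarrow> 'y) lY rY \<phi>.
      bimodule sA sY lY rY \<longrightarrow> bilinear_map sA sA sY \<phi> \<longrightarrow>
      (\<forall>a b. a * b = 0 \<longrightarrow> \<phi> a b = 0) \<longrightarrow>
      (\<forall>a b c. \<phi> (a * b) c = \<phi> a (b * c)))"

text \<open>A single proposition cannot quantify over all types \<open>'y\<close>. It is enough to let \<open>Y\<close> range
  over the bimodules on the additive group of \<open>'a\<close>: by lemma \<open>property_B_all\<close> below, this gives
  the condition for the bimodules on every type.\<close>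

definition property_B :: "(complex \<Rightarrow> 'a::ring \<Rightarrow> 'a) \<Rightarrow> bool" where
  "property_B sA \<longleftrightarrow> property_B_on TYPE('a) sA"

lemma property_B_all:
  fixes sA :: "complex \<Rightarrow> 'a::ring \<Rightarrow> 'a"
  assumes A: "complex_algebra sA" and B: "property_B sA"
  shows "property_B_on TYPE('y::ab_group_add) sA"
  unfolding property_B_on_def
proof (intro allI impI)
  fix sY :: "complex \<Rightarrow> 'y \<Rightarrow> 'y" and lY rY \<phi> and a b c :: 'a
  assume Y: "bimodule sA sY lY rY" and bil: "bilinear_map sA sA sY \<phi>"
    and zero: "\<forall>a b. a * b = 0 \<longrightarrow> \<phi> a b = 0"
  interpret A: complex_algebra sA by (rule A)
  interpret Y: bimodule sA sY lY rY by (rule Y)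
  interpret YA: vector_space_pair sY sA ..
  interpret AA: vector_space_pair sA sA ..
  show "\<phi> (a * b) c = \<phi> a (b * c)"
  proof (rule ccontr)
    assume ne: "\<phi> (a * b) c \<noteq> \<phi> a (b * c)"
    define v where "v = \<phi> (a * b) c - \<phi> a (b * c)"
    have "v \<noteq> 0" using ne by (simp add: v_def)
    have "\<exists>e::'a. e \<noteq> 0"
    proof (rule ccontr)
      assume "\<nexists>e::'a. e \<noteq> 0"
      then have "x * y = 0" for x y :: 'a by blast
      then show False using zero ne by auto
    qed
    then obtain e :: 'a where e: "e \<noteq> 0" by blast
    have "Y.X.independent {v}" using \<open>v \<noteq> 0\<close> by simp
    then obtain g where g: "Vector_Spaces.linear sY sA g" "g v = e"
      using YA.linear_independent_extend[of "{v}" "\<lambda>_. e"] by auto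
    interpret g: Vector_Spaces.linear sY sA g by (rule g(1))
    have zl: "Vector_Spaces.linear sA sA (\<lambda>_. 0)" by (rule AA.linear_zero)
    have triv: "bimodule sA sA (\<lambda>_ _. 0) (\<lambda>_ _. 0)"
      by unfold_locales (auto simp: bilinear_map_def zl)
    have bil': "bilinear_map sA sA sA (\<lambda>x y. g (\<phi> x y))"
      using bil Vector_Spaces.linear_compose[OF _ g(1)]
      unfolding bilinear_map_def by (auto simp: o_def)
    have "\<forall>x y. x * y = 0 \<longrightarrow> g (\<phi> x y) = 0"
      using zero g.zero by auto
    with triv bil' B have "g (\<phi> (a * b) c) = g (\<phi> a (b * c))"
      unfolding property_B_def property_B_on_def by blast
    then have "g v = 0" by (simp add: v_def g.diff)
    with g(2) e show False by simp
  qed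
qed

context bimodule
begin

definition anti_derivable_at_zero :: "('a \<Rightarrow> 'x) \<Rightarrow> bool" where
  "anti_derivable_at_zero T \<longleftrightarrow> Vector_Spaces.linear sA sX T \<and>
    (\<forall>a b. a * b = 0 \<longrightarrow> T b \<lhd> a + b \<rhd> T a = 0)"

definition derivation :: "('a \<Rightarrow> 'x) \<Rightarrow> bool" where
  "derivation d \<longleftrightarrow> Vector_Spaces.linear sA sX d \<and>
    (\<forall>a b. d (a * b) = d a \<lhd> b + a \<rhd> d b)"

definition jordan_derivation :: "('a \<Rightarrow> 'x) \<Rightarrow> bool" where
  "jordan_derivation d \<longleftrightarrow> Vector_Spaces.linear sA sX d \<and>
    (\<forall>a. d (a * a) = d a \<lhd> a + a \<rhd> d a)"

definition generalized_derivation :: "('a \<Rightarrow> 'x) \<Rightarrow> bool" where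
  "generalized_derivation T \<longleftrightarrow> Vector_Spaces.linear sA sX T \<and>
    (\<exists>\<xi>. \<forall>a b. T (a * b) = T a \<lhd> b + a \<rhd> T b - (a \<rhd> \<xi>) \<lhd> b)"

end

text \<open>In the unital case the element \<open>\<xi>\<close> is necessarily \<open>T 1\<close>.\<close>

lemma (in unital_bimodule) generalized_derivation_iff:
  "generalized_derivation T \<longleftrightarrow> Vector_Spaces.linear sA sX T \<and>
    (\<forall>a b. T (a * b) = T a \<lhd> b + a \<rhd> T b - (a \<rhd> T 1) \<lhd> b)"
proof -
  have "\<xi> = T 1" if "\<forall>a b. T (a * b) = T a \<lhd> b + a \<rhd> T b - (a \<rhd> \<xi>) \<lhd> b" for \<xi>
    using that[rule_format, of 1 1] by (simp add: lact_one ract_one)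
  then show ?thesis unfolding generalized_derivation_def by blast
qed

definition commutator :: "'a::ring \<Rightarrow> 'a \<Rightarrow> 'a" where
  "commutator a b = a * b - b * a"

end

theory Submission
  imports Defs
begin

text \<open>Apply property \<open>\<bool>\<close> to the bilinear map \<open>\<phi>(a, b) = T(b) a + b T(a)\<close>, whose vanishing on
  the pairs with \<open>a b = 0\<close> is exactly anti-derivability at zero. The result
  \<open>\<phi>(a b, c) = \<phi>(a, b c)\<close> is an identity valid for all elements. With \<open>c = 1\<close> it is the
  product formula \<open>T(a b) = T(b) a + b T(a) - \<xi> a b\<close>, where \<open>\<xi> = T(1)\<close>. With \<open>a = c = 1\<close> it
  says that \<open>\<xi>\<close> commutes with \<open>A\<close>. Hence \<open>d(a) = T(a) - \<xi> a\<close> satisfies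
  \<open>d(a b) = d(b) a + b d(a) - 2 \<xi> [a, b]\<close> (lemma \<open>shifted_mult\<close>). The commutator vanishes at
  \<open>b = a\<close>, so \<open>d\<close> is a Jordan derivation.

  If \<open>d\<close> is even a derivation, then \<open>d(b) a + b d(a) = d(b a)\<close>, and the same formula becomes
  \<open>d([a, b]) = -2 \<xi> [a, b]\<close>. Conversely, this commutator identity at \<open>a b = 0\<close> is the orthogonality
  condition on \<open>d\<close> in (ii). That condition is in turn a restatement of anti-derivability of \<open>T\<close>,
  because replacing \<open>d\<close> by \<open>T\<close> adds \<open>\<xi> b a\<close> to each of the two summands
  (lemma \<open>anti_derivable_iff_shifted\<close>).\<close>

section \<open>Bimodule arithmetic\<close>

context bimodule
begin

lemma linear_lact: "Vector_Spaces.linear sX sX (\<lambda>x. a \<rhd> x)"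
  and linear_lact_left: "Vector_Spaces.linear sA sX (\<lambda>a. a \<rhd> x)"
  and linear_ract: "Vector_Spaces.linear sX sX (\<lambda>x. x \<lhd> a)"
  and linear_ract_right: "Vector_Spaces.linear sA sX (\<lambda>a. x \<lhd> a)"
  using bilinear_lact bilinear_ract unfolding bilinear_map_def by auto

lemma lact_add: "a \<rhd> (x + y) = a \<rhd> x + a \<rhd> y"
  and ract_add: "(x + y) \<lhd> a = x \<lhd> a + y \<lhd> a"
  and ract_diff_right: "x \<lhd> (a - b) = x \<lhd> a - x \<lhd> b"
  and ract_zero_right: "x \<lhd> 0 = 0"
  using module_hom.add[OF linear_lact[unfolded linear_iff_module_hom]]
    module_hom.add[OF linear_ract[unfolded linear_iff_module_hom]]
    module_hom.diff[OF linear_ract_right[unfolded linear_iff_module_hom]]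
    module_hom.zero[OF linear_ract_right[unfolded linear_iff_module_hom]]
  by blast+

lemma scale_minus_two: "sX (- 2) x = - (x + x)"
proof -
  have "sX (1 + 1) x = x + x"
    by (simp only: X.scale_left_distrib X.scale_one)
  then show ?thesis by simp
qed

section \<open>From anti-derivability to a product formula\<close>

lemma bilinear_anti_derivable_form:
  assumes T: "Vector_Spaces.linear sA sX T"
  shows "bilinear_map sA sA sX (\<lambda>a b. T b \<lhd> a + b \<rhd> T a)"
proof -
  interpret AX: vector_space_pair sA sX ..
  have "Vector_Spaces.linear sA sX (\<lambda>b. T b \<lhd> a)" and "Vector_Spaces.linear sA sX (\<lambda>a. b \<rhd> T a)"
    for a b
    using Vector_Spaces.linear_compose[OF T linear_ract] Vector_Spaces.linear_compose[OF T linear_lact]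
    by (simp_all add: o_def)
  then show ?thesis
    unfolding bilinear_map_def
    by (auto intro!: AX.linear_compose_add linear_lact_left linear_ract_right)
qed

lemma anti_derivable_shift:
  assumes B: "property_B sA" and T: "anti_derivable_at_zero T"
  shows "T c \<lhd> (a * b) + c \<rhd> T (a * b) = T (b * c) \<lhd> a + (b * c) \<rhd> T a"
proof -
  have "property_B_on TYPE('x) sA"
    using property_B_all[OF _ B] complex_algebra_axioms by blast
  moreover have "bilinear_map sA sA sX (\<lambda>a b. T b \<lhd> a + b \<rhd> T a)"
    using T bilinear_anti_derivable_form unfolding anti_derivable_at_zero_def by blast
  moreover have "\<forall>a b. a * b = 0 \<longrightarrow> T b \<lhd> a + b \<rhd> T a = 0"
    using T unfolding anti_derivable_at_zero_def by blast
  ultimately show ?thesis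
    using bimodule_axioms unfolding property_B_on_def by blast
qed

end

context unital_bimodule
begin

lemma anti_derivable_mult:
  assumes "property_B sA" "anti_derivable_at_zero T"
  shows "T (a * b) = T b \<lhd> a + b \<rhd> T a - T 1 \<lhd> (a * b)"
  using anti_derivable_shift[OF assms, of 1 a b] by (simp add: lact_one algebra_simps)

text \<open>The form \<open>\<phi>(a, b) = T(b) a + b T(a)\<close> has the same value at \<open>(a, 1)\<close> and \<open>(1, a)\<close>. Both values
  contain the summand \<open>T(a)\<close>, and what remains is \<open>T(1)\<close> acted on by \<open>a\<close> from opposite sides.\<close>

lemma anti_derivable_central:
  assumes "property_B sA" "anti_derivable_at_zero T"
  shows "T 1 \<lhd> a = a \<rhd> T 1"
  using anti_derivable_shift[OF assms, of 1 1 a] by (simp add: lact_one ract_one add.commute)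

section \<open>Subtracting the central multiplication\<close>

text \<open>When \<open>\<xi>\<close> is central, left and right multiplication by it coincide, so the multiplication part
  of \<open>T\<close> contributes \<open>\<xi> b a\<close> to each summand.\<close>

lemma anti_derivable_form_shifted:
  assumes central: "\<And>a. \<xi> \<lhd> a = a \<rhd> \<xi>" and T: "\<And>a. T a = d a + \<xi> \<lhd> a"
  shows "T b \<lhd> a + b \<rhd> T a = d b \<lhd> a + b \<rhd> d a - sX (- 2) (\<xi> \<lhd> (b * a))"
proof -
  have "b \<rhd> (\<xi> \<lhd> a) = \<xi> \<lhd> (b * a)"
    by (simp add: central lact_mult)
  then show ?thesis
    unfolding scale_minus_two by (simp add: T lact_add ract_add ract_mult)
qed

lemma anti_derivable_iff_shifted:
  assumes lin: "Vector_Spaces.linear sA sX T"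
    and central: "\<And>a. \<xi> \<lhd> a = a \<rhd> \<xi>" and T: "\<And>a. T a = d a + \<xi> \<lhd> a"
  shows "anti_derivable_at_zero T \<longleftrightarrow>
    (\<forall>a b. a * b = 0 \<longrightarrow> d b \<lhd> a + b \<rhd> d a = sX (- 2) (\<xi> \<lhd> (b * a)))"
  using lin unfolding anti_derivable_at_zero_def anti_derivable_form_shifted[OF central T] right_minus_eq
  by blast

lemma linear_shifted:
  assumes "Vector_Spaces.linear sA sX T"
  shows "Vector_Spaces.linear sA sX (\<lambda>a. T a - \<xi> \<lhd> a)"
proof -
  interpret AX: vector_space_pair sA sX ..
  show ?thesis by (rule AX.linear_compose_sub[OF assms linear_ract_right])
qed

text \<open>The commutator collects two contributions: \<open>2 \<xi> b a\<close> from writing \<open>T(b) a + b T(a)\<close> in terms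
  of \<open>d\<close>, and \<open>-2 \<xi> a b\<close>, once from the product formula for \<open>T\<close> and once from \<open>d(a b)\<close> itself.\<close>

lemma shifted_mult:
  assumes "property_B sA" "anti_derivable_at_zero T" and T: "\<And>a. T a = d a + T 1 \<lhd> a"
  shows "d (a * b) = d b \<lhd> a + b \<rhd> d a + sX (- 2) (T 1 \<lhd> commutator a b)"
proof -
  note central = anti_derivable_central[OF assms(1,2)]
  have "d (a * b) = T (a * b) - T 1 \<lhd> (a * b)"
    using T[of "a * b"] by (simp add: algebra_simps)
  also have "\<dots> = T b \<lhd> a + b \<rhd> T a - T 1 \<lhd> (a * b) - T 1 \<lhd> (a * b)"
    by (simp only: anti_derivable_mult[OF assms(1,2), of a b])
  also have "\<dots> = d b \<lhd> a + b \<rhd> d a + sX (- 2) (T 1 \<lhd> commutator a b)"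
    unfolding anti_derivable_form_shifted[OF central T]
    by (simp only: scale_minus_two commutator_def ract_diff_right) (simp add: algebra_simps)
  finally show ?thesis .
qed

lemma shifted_jordan:
  assumes "property_B sA" "anti_derivable_at_zero T" "\<And>a. T a = d a + T 1 \<lhd> a"
    and "Vector_Spaces.linear sA sX d"
  shows "jordan_derivation d"
  using assms(4) shifted_mult[OF assms(1-3)] unfolding jordan_derivation_def
  by (simp add: commutator_def ract_zero_right)

section \<open>The derivation case\<close>

lemma derivation_commutator:
  assumes "property_B sA" "anti_derivable_at_zero T" "\<And>a. T a = d a + T 1 \<lhd> a"
    and d: "derivation d"
  shows "d (commutator a b) = sX (- 2) (T 1 \<lhd> commutator a b)"
proof -
  have lin: "module_hom sA sX d" and mult: "d (b * a) = d b \<lhd> a + b \<rhd> d a"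
    using d unfolding derivation_def linear_iff_module_hom by auto
  have "d (commutator a b) = d (a * b) - d (b * a)"
    unfolding commutator_def by (rule module_hom.diff[OF lin])
  then show ?thesis
    unfolding shifted_mult[OF assms(1-3), of a b] mult by simp
qed

text \<open>If \<open>a b = 0\<close>, then \<open>b a = [b, a]\<close>, so the commutator identity gives \<open>d(b a)\<close>.\<close>

lemma derivation_orthogonal:
  assumes d: "derivation d"
    and comm: "\<And>a b. d (commutator a b) = sX (- 2) (\<xi> \<lhd> commutator a b)"
    and "a * b = 0"
  shows "d b \<lhd> a + b \<rhd> d a = sX (- 2) (\<xi> \<lhd> (b * a))"
proof -
  have "d b \<lhd> a + b \<rhd> d a = d (commutator b a)"
    using d \<open>a * b = 0\<close> unfolding derivation_def commutator_def by simp
  then show ?thesis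
    using \<open>a * b = 0\<close> unfolding comm by (simp add: commutator_def)
qed

lemma derivation_plus_central_generalized:
  assumes lin: "Vector_Spaces.linear sA sX T" and d: "derivation d"
    and central: "\<And>a. \<xi> \<lhd> a = a \<rhd> \<xi>" and T: "\<And>a. T a = d a + \<xi> \<lhd> a"
  shows "generalized_derivation T"
proof -
  have "T (a * b) = T a \<lhd> b + a \<rhd> T b - (a \<rhd> \<xi>) \<lhd> b" for a b
  proof -
    have "d (a * b) = d a \<lhd> b + a \<rhd> d b"
      using d unfolding derivation_def by blast
    then show ?thesis
      by (simp add: T lact_add ract_add ract_mult flip: central lact_ract)
  qed
  with lin show ?thesis unfolding generalized_derivation_def by blast
qed

end

section \<open>The equivalences\<close>

theorem mainTheorem3:
  fixes sA :: "complex \<Rightarrow> 'a::{ring,monoid_mult} \<Rightarrow> 'a"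
    and sX :: "complex \<Rightarrow> 'x::ab_group_add \<Rightarrow> 'x"
    and lact :: "'a \<Rightarrow> 'x \<Rightarrow> 'x" (infixr "\<rhd>" 70)
    and ract :: "'x \<Rightarrow> 'a \<Rightarrow> 'x" (infixl "\<lhd>" 70)
    and T :: "'a \<Rightarrow> 'x"
  assumes A: "complex_algebra sA"
    and B: "property_B sA"
    and X: "unital_bimodule sA sX (\<rhd>) (\<lhd>)"
    and T: "Vector_Spaces.linear sA sX T"
  defines "i \<equiv> bimodule.anti_derivable_at_zero sA sX (\<rhd>) (\<lhd>) T"
    and "central \<equiv> (\<forall>a. T 1 \<lhd> a = a \<rhd> T 1)"
    and "decomp_ii \<equiv> (\<lambda>d. Vector_Spaces.linear sA sX d \<and>
           (\<forall>a. T a = d a + T 1 \<lhd> a) \<and>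
           (\<forall>a b. a * b = 0 \<longrightarrow> d b \<lhd> a + b \<rhd> d a = sX (- 2) (T 1 \<lhd> (b * a))))"
    and "iii \<equiv> (\<forall>a. T 1 \<lhd> a = a \<rhd> T 1) \<and>
           (\<exists>d. bimodule.derivation sA sX (\<rhd>) (\<lhd>) d \<and>
             (\<forall>a. T a = d a + T 1 \<lhd> a) \<and>
             (\<forall>a b. d (commutator a b) = sX (- 2) (T 1 \<lhd> commutator a b)))"
  shows "(i \<longleftrightarrow> central \<and> (\<exists>d. decomp_ii d)) \<and>
    (\<forall>d. central \<longrightarrow> decomp_ii d \<longrightarrow> bimodule.jordan_derivation sA sX (\<rhd>) (\<lhd>) d) \<and>
    ((\<forall>d. bimodule.jordan_derivation sA sX (\<rhd>) (\<lhd>) d \<longrightarrow>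
          bimodule.derivation sA sX (\<rhd>) (\<lhd>) d) \<longrightarrow>
      (i \<longleftrightarrow> iii) \<and>
      (iii \<longrightarrow> bimodule.generalized_derivation sA sX (\<rhd>) (\<lhd>) T))"
proof -
  interpret unital_bimodule sA sX lact ract by (rule X)
  have i_central: central if i
    using anti_derivable_central[OF B] that unfolding i_def central_def by blast
  have i_iff: "i \<longleftrightarrow> (\<forall>a b. a * b = 0 \<longrightarrow> d b \<lhd> a + b \<rhd> d a = sX (- 2) (T 1 \<lhd> (b * a)))"
    if central and "\<And>a. T a = d a + T 1 \<lhd> a" for d
    using anti_derivable_iff_shifted[OF T, of "T 1" d] that unfolding i_def central_def by blast
  have decomp_i: i if central "decomp_ii d" for d
    using i_iff[of d] that unfolding decomp_ii_def by blast
  define d0 where "d0 = (\<lambda>a. T a - T 1 \<lhd> a)"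
  have d0: "Vector_Spaces.linear sA sX d0" "\<And>a. T a = d0 a + T 1 \<lhd> a"
    unfolding d0_def by (rule linear_shifted[OF T]) simp
  have i_decomp: "decomp_ii d0" if i
    using d0 i_iff[OF i_central[OF that] d0(2)] that unfolding decomp_ii_def by blast
  have jordan: "jordan_derivation d" if central "decomp_ii d" for d
    using shifted_jordan[OF B] decomp_i[OF that] that(2) unfolding i_def decomp_ii_def by blast
  have i_iii: iii if jd: "\<forall>d. jordan_derivation d \<longrightarrow> derivation d" and i
  proof -
    have der: "derivation d0"
      using jd jordan i_central i_decomp \<open>i\<close> by blast
    moreover have "d0 (commutator a b) = sX (- 2) (T 1 \<lhd> commutator a b)" for a b
      using derivation_commutator[OF B _ d0(2) der] \<open>i\<close> unfolding i_def by blast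
    ultimately show iii
      using d0(2) i_central[OF \<open>i\<close>] unfolding iii_def central_def by blast
  qed
  have iii_i: i if h: iii
  proof -
    obtain d where central and d: "derivation d" "\<And>a. T a = d a + T 1 \<lhd> a"
      "\<And>a b. d (commutator a b) = sX (- 2) (T 1 \<lhd> commutator a b)"
      using h unfolding iii_def central_def by blast
    then show i
      using i_iff[OF \<open>central\<close> d(2)] derivation_orthogonal[OF d(1,3)] by blast
  qed
  have iii_gen: "generalized_derivation T" if iii
    using that derivation_plus_central_generalized[OF T] unfolding iii_def by blast
  show ?thesis
    using i_central i_decomp decomp_i jordan i_iii iii_i iii_gen by blast
qed

end
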